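(* Let $X \subset \mathbb{R}$ be a Cantor set with positive Hausdorff dimension. Then $X$ is not measure universal.
   Context: A Cantor set in $\mathbb{R}$ is a (nonempty) compact, totally disconnected, perfect subset of $\mathbb{R}$. A set $A \subset \mathbb{R}$ is called measure universal if for every Lebesgue measurable set $E \subset \mathbb{R}$ of positive Lebesgue measure there exist $\lambda \in \mathbb{R}\setminus\{0\}$ and $t \in \mathbb{R}$ such that $\lambda A + t \subset E$, where $\lambda A + t = \{\lambda a + t : a \in A\}$. *)

theory Defs
  imports "HOL-Analysis.Analysis"
begin

(* The derived-set equation says at once that A is closed and has no isolated points. *)
definition perfect_set :: "'a::topological_space set \<Rightarrow> bool" where
  "perfect_set A \<longleftrightarrow> {x. x islimpt A} = A"

definition totally_disconnected_set :: "'a::topological_space set \<Rightarrow> bool" where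
  "totally_disconnected_set A \<longleftrightarrow> (\<forall>x\<in>A. connected_component_set A x = {x})"

definition cantor_set :: "real set \<Rightarrow> bool" where
  "cantor_set A \<longleftrightarrow> A \<noteq> {} \<and> compact A \<and> totally_disconnected_set A \<and> perfect_set A"

(* The summand diam(U)^s, with diam({})^s = 0 for all s, and diam(U)^0 = 1 for nonempty U
   (0 powr 0 = 0, so the case s = 0 has to be treated separately). *)
definition diam_pow :: "real \<Rightarrow> 'a::metric_space set \<Rightarrow> ennreal" where
  "diam_pow s U = (if U = {} then 0 else if s = 0 then 1 else ennreal (diameter U powr s))"

(* Countable covers by sets of diameter at most d, as sequences; finite covers are padded with {}.
   Boundedness is stated separately because diameter is unspecified on unbounded sets. *)
definition diam_covers :: "real \<Rightarrow> 'a::metric_space set \<Rightarrow> (nat \<Rightarrow> 'a set) set" where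
  "diam_covers d A = {U. A \<subseteq> (\<Union>i. U i) \<and> (\<forall>i. bounded (U i) \<and> diameter (U i) \<le> d)}"

definition hausdorff_content_upto :: "real \<Rightarrow> real \<Rightarrow> 'a::metric_space set \<Rightarrow> ennreal" where
  "hausdorff_content_upto s d A = (INF U\<in>diam_covers d A. \<Sum>i. diam_pow s (U i))"

definition hausdorff_measure :: "real \<Rightarrow> 'a::metric_space set \<Rightarrow> ennreal" where
  "hausdorff_measure s A = (SUP d\<in>{0<..}. hausdorff_content_upto s d A)"

(* The infimum is taken in ennreal, so it is \<infinity> if no s qualifies. *)
definition hausdorff_dim :: "'a::metric_space set \<Rightarrow> ennreal" where
  "hausdorff_dim A = (INF s\<in>{s. 0 \<le> s \<and> hausdorff_measure s A = 0}. ennreal s)"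

definition measure_universal :: "real set \<Rightarrow> bool" where
  "measure_universal A \<longleftrightarrow>
    (\<forall>E. E \<in> sets lebesgue \<and> emeasure lebesgue E > 0 \<longrightarrow>
      (\<exists>c t. c \<noteq> 0 \<and> (\<lambda>a. c * a + t) ` A \<subseteq> E))"

end

theory Submission
  imports Defs "HOL-Real_Asymp.Real_Asymp"
begin

text \<open>
  Besides boundedness, the only property of \<open>X\<close> that matters is a lower bound on covering
  numbers: a set of positive dimension needs at least \<open>C * \<rho> powr (-s)\<close> sets of diameter
  \<open>\<rho>\<close> to be covered, for some \<open>s > 0\<close> and all small \<open>\<rho>\<close>
  (\<open>positive_dim_finite_cover_bound\<close>). At resolution \<open>1/m\<close> an affine copy of \<open>X\<close> inside
  \<open>{0..1}\<close> with a scale factor bounded away from \<open>0\<close> therefore occupies at least about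
  \<open>m powr s\<close> of the \<open>m\<close> cells of length \<open>1/m\<close>. If the scale factor is also bounded above, then
  rounding it and the translation to a grid leaves only \<open>O(m^2)\<close> patterns of occupied cells.

  So there are polynomially many subsets of a universe of size about \<open>m\<close>, each of size at least
  about \<open>m powr s\<close>. By the greedy argument (\<open>greedy_hitting_set\<close>) some \<open>O(m powr (1-s) * ln m)\<close>
  cells meet all of them. Thickened by the rounding error, these cells have total
  length \<open>O(m powr (-s) * ln m)\<close>, which tends to \<open>0\<close>. Hence an arbitrarily small set meets
  all copies of \<open>X\<close> in \<open>{0..1}\<close> with scale factor in a given compact range
  (\<open>small_set_meeting_affine_copies\<close>). Exhausting the nonzero scale factors by countably many such
  ranges and removing from \<open>{0..1}\<close> the corresponding sets, of total measure at most \<open>1/2\<close>, leaves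
  a set of positive measure that contains no affine copy of \<open>X\<close>.
\<close>

section \<open>Covering numbers of sets of positive dimension\<close>

lemma content_le_finite_cover:
  fixes A :: "'a::metric_space set" and V :: "'b \<Rightarrow> 'a set"
  assumes "finite K" "A \<subseteq> (\<Union>k\<in>K. V k)" and V: "\<And>k. k \<in> K \<Longrightarrow> bounded (V k) \<and> diameter (V k) \<le> \<rho>"
    and "0 \<le> \<rho>" "\<rho> \<le> d" "0 < s"
  shows "hausdorff_content_upto s d A \<le> ennreal (real (card K) * \<rho> powr s)"
proof -
  obtain g where g: "bij_betw g {..<card K} K"
    using ex_bij_betw_nat_finite[OF \<open>finite K\<close>] by (auto simp: atLeast0LessThan)
  define U where "U i = (if i < card K then V (g i) else {})" for i
  have gK: "g i \<in> K" if "i < card K" for i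
    using g that by (auto simp: bij_betw_def)
  have "A \<subseteq> (\<Union>i. U i)"
  proof
    fix x assume "x \<in> A"
    then obtain k where k: "k \<in> K" "x \<in> V k" using assms(2) by auto
    then obtain i where "i < card K" "g i = k" using g by (force simp: bij_betw_def)
    then show "x \<in> (\<Union>i. U i)" using k by (auto simp: U_def intro!: exI[of _ i])
  qed
  moreover have "bounded (U i) \<and> diameter (U i) \<le> d" for i
    using V[OF gK] assms(4,5) by (fastforce simp: U_def)
  ultimately have "U \<in> diam_covers d A" by (simp add: diam_covers_def)
  then have "hausdorff_content_upto s d A \<le> (\<Sum>i. diam_pow s (U i))"
    unfolding hausdorff_content_upto_def by (rule INF_lower)
  also have "\<dots> = (\<Sum>i<card K. diam_pow s (U i))"
    by (rule suminf_finite) (auto simp: U_def diam_pow_def)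
  also have "\<dots> \<le> (\<Sum>i<card K. ennreal (\<rho> powr s))"
  proof (rule sum_mono)
    fix i assume "i \<in> {..<card K}"
    then have "bounded (U i)" "diameter (U i) \<le> \<rho>" using V[OF gK] by (auto simp: U_def)
    then show "diam_pow s (U i) \<le> ennreal (\<rho> powr s)"
      using \<open>0 < s\<close> by (auto simp: diam_pow_def intro!: ennreal_leI powr_mono2 diameter_ge_0)
  qed
  also have "\<dots> = ennreal (real (card K) * \<rho> powr s)"
    by (simp add: ennreal_mult ennreal_of_nat_eq_real_of_nat)
  finally show ?thesis .
qed

text \<open>
  For \<open>s\<close> strictly between \<open>0\<close> and the dimension, the \<open>s\<close>-dimensional measure is nonzero, so the
  content is already positive for some \<open>d\<close>. Every finite cover at a finer scale is a competitor in
  the infimum that defines this content.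
\<close>

lemma positive_dim_finite_cover_bound:
  fixes X :: "'a::metric_space set"
  assumes "hausdorff_dim X > 0"
  obtains s c d where "0 < s" "0 < c" "0 < d"
    "\<And>(K::'b set) V \<rho>. \<lbrakk>finite K; X \<subseteq> (\<Union>k\<in>K. V k); \<And>k. k \<in> K \<Longrightarrow> bounded (V k) \<and> diameter (V k) \<le> \<rho>;
       0 < \<rho>; \<rho> \<le> d\<rbrakk> \<Longrightarrow> c \<le> real (card K) * \<rho> powr s"
proof -
  obtain s' where s': "0 < s'" "s' < hausdorff_dim X" using dense[OF assms] by auto
  then obtain s where s: "s' = ennreal s" "0 < s"
    by (cases s') auto
  have "hausdorff_measure s X \<noteq> 0"
  proof
    assume "hausdorff_measure s X = 0"
    then have "hausdorff_dim X \<le> ennreal s"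
      unfolding hausdorff_dim_def using s by (intro INF_lower) auto
    then show False using s' s by auto
  qed
  then have "0 < (SUP d\<in>{0<..}. hausdorff_content_upto s d X)"
    by (simp add: hausdorff_measure_def zero_less_iff_neq_zero)
  then obtain d where d: "0 < d" "0 < hausdorff_content_upto s d X"
    by (auto simp: less_SUP_iff)
  obtain c' where c': "0 < c'" "c' < hausdorff_content_upto s d X" using dense[OF d(2)] by auto
  then obtain c where c: "c' = ennreal c" "0 < c" by (cases c') auto
  show ?thesis
  proof (rule that[OF s(2) c(2) d(1)])
    fix K :: "'b set" and V and \<rho> :: real
    assume *: "finite K" "X \<subseteq> (\<Union>k\<in>K. V k)" "\<And>k. k \<in> K \<Longrightarrow> bounded (V k) \<and> diameter (V k) \<le> \<rho>"
      "0 < \<rho>" "\<rho> \<le> d"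
    have "ennreal c \<le> ennreal (real (card K) * \<rho> powr s)"
      using content_le_finite_cover[OF *(1,2,3) _ *(5) s(2)] *(4) c'(2)
      unfolding c(1) by (meson less_imp_le order.trans)
    then show "c \<le> real (card K) * \<rho> powr s"
      by (subst (asm) ennreal_le_iff) auto
  qed
qed

section \<open>Small hitting sets\<close>

text \<open>
  A point of \<open>U\<close> chosen at random lies in each member of \<open>F\<close> with probability at least
  \<open>n / card U\<close>. Some point therefore lies in at least this fraction of the members not yet
  met; adding such a point \<open>r\<close> times multiplies the number of unmet members by at most
  \<open>(1 - n / card U) ^ r\<close>. Once the bound is below \<open>1\<close>, all members are met.
\<close>

lemma greedy_hitting_set:
  fixes F :: "'a set set"
  assumes "finite U" "finite F" and F: "\<And>S. S \<in> F \<Longrightarrow> S \<subseteq> U \<and> n \<le> real (card S)"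
  shows "\<exists>H\<subseteq>U. card H \<le> r \<and> real (card {S \<in> F. S \<inter> H = {}}) \<le> real (card F) * (1 - n / real (card U)) ^ r"
proof (cases "F = {} \<or> U = {}")
  case True
  then show ?thesis
  proof
    assume "U = {}"
    then show ?thesis by (auto intro!: card_mono assms)
  qed auto
next
  case False
  show ?thesis
  proof (induction r)
    case 0
    show ?case using assms by (auto intro!: exI[of _ "{}"] card_mono)
  next
    case (Suc r)
    then obtain H where H: "H \<subseteq> U" "card H \<le> r"
      "real (card {S \<in> F. S \<inter> H = {}}) \<le> real (card F) * (1 - n / real (card U)) ^ r" by blast
    define F' where "F' = {S \<in> F. S \<inter> H = {}}"
    have fin: "finite F'" using assms by (simp add: F'_def)
    have cU: "card U > 0" using False assms by auto
    have nU: "n \<le> real (card U)"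
    proof -
      obtain S where "S \<in> F" using False by auto
      then show ?thesis using F[of S] card_mono[OF \<open>finite U\<close>, of S] by linarith
    qed
    \<comment> \<open>Averaging: count the pairs of a point and an unmet set containing it in both orders.\<close>
    have "\<exists>u\<in>U. n * real (card F') / real (card U) \<le> real (card {S \<in> F'. u \<in> S})"
    proof (rule ccontr)
      assume "\<not> ?thesis"
      then have "(\<Sum>u\<in>U. real (card {S \<in> F'. u \<in> S})) < (\<Sum>u\<in>U. n * real (card F') / real (card U))"
        using False assms by (intro sum_strict_mono) (auto simp: not_le)
      also have "\<dots> = (\<Sum>S\<in>F'. n)" using cU by simp
      also have "\<dots> \<le> (\<Sum>S\<in>F'. real (card {u \<in> U. u \<in> S}))"
      proof (rule sum_mono)
        fix S assume "S \<in> F'"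
        then have "{u \<in> U. u \<in> S} = S" "n \<le> real (card S)" using F[of S] by (auto simp: F'_def)
        then show "n \<le> real (card {u \<in> U. u \<in> S})" by simp
      qed
      also have "\<dots> = (\<Sum>u\<in>U. real (card {S \<in> F'. u \<in> S}))"
        unfolding of_nat_sum[symmetric] of_nat_eq_iff
        using fin \<open>finite U\<close> by (intro sum_multicount_gen) auto
      finally show False by simp
    qed
    then obtain u where u: "u \<in> U" "n * real (card F') / real (card U) \<le> real (card {S \<in> F'. u \<in> S})"
      by blast
    have "{S \<in> F. S \<inter> insert u H = {}} = F' - {S \<in> F'. u \<in> S}" by (auto simp: F'_def)
    then have "real (card {S \<in> F. S \<inter> insert u H = {}}) = real (card F') - real (card {S \<in> F'. u \<in> S})"
      using fin by (simp add: card_Diff_subset card_mono of_nat_diff)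
    also have "\<dots> \<le> real (card F') * (1 - n / real (card U))"
      using u(2) by (simp add: algebra_simps)
    also have "\<dots> \<le> (real (card F) * (1 - n / real (card U)) ^ r) * (1 - n / real (card U))"
      using H(3) nU cU by (intro mult_right_mono) (auto simp: F'_def)
    finally show ?case
      using H u(1) finite_subset[OF H(1) \<open>finite U\<close>]
      by (intro exI[of _ "insert u H"]) (simp add: card_insert_if mult_ac)
  qed
qed

section \<open>Small sets meeting all affine copies of a bounded range of scales\<close>

text \<open>
  The grid for \<open>(x, t)\<close> is chosen with mesh \<open>1/m\<close> in \<open>x\<close> and \<open>1/(m*M)\<close> in \<open>t\<close>, where
  \<open>\<bar>a\<bar> \<le> M\<close> on \<open>X\<close>, so that rounding moves every point \<open>t * a + x\<close> by at most \<open>2/m\<close>. The lower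
  bound on \<open>\<bar>t\<bar>\<close> makes each copy occupy many cells; the upper bound keeps the number of grid
  points polynomial in \<open>m\<close>.
\<close>

lemma small_set_meeting_affine_copies:
  fixes X :: "real set"
  assumes "bounded X" "hausdorff_dim X > 0" "0 < \<alpha>" "0 < \<epsilon>"
  obtains F where "F \<in> lmeasurable" "measure lebesgue F \<le> \<epsilon>"
    "\<And>x t. \<lbrakk>\<alpha> \<le> \<bar>t\<bar>; \<bar>t\<bar> \<le> \<beta>; (\<lambda>a. t * a + x) ` X \<subseteq> {0..1}\<rbrakk> \<Longrightarrow> (\<lambda>a. t * a + x) ` X \<inter> F \<noteq> {}"
proof -
  obtain s c d where scd: "0 < s" "0 < c" "0 < d"
    and cover: "\<And>(K::int set) V \<rho>. \<lbrakk>finite K; X \<subseteq> (\<Union>k\<in>K. V k);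
      \<And>k. k \<in> K \<Longrightarrow> bounded (V k) \<and> diameter (V k) \<le> \<rho>; 0 < \<rho>; \<rho> \<le> d\<rbrakk>
      \<Longrightarrow> c \<le> real (card K) * \<rho> powr s"
    using positive_dim_finite_cover_bound[OF assms(2)] by metis
  \<comment> \<open>The empty family would cover an empty \<open>X\<close>, against the bound.\<close>
  have "X \<noteq> {}"
    using cover[of "{}" "\<lambda>_. {}" d] scd by auto
  then obtain a0 where "a0 \<in> X" by auto
  obtain M where M: "1 \<le> M" "\<And>a. a \<in> X \<Longrightarrow> \<bar>a\<bar> \<le> M"
  proof -
    obtain M0 where "\<forall>a\<in>X. norm a \<le> M0" using assms(1) by (auto simp: bounded_iff)
    then show ?thesis by (intro that[of "max 1 M0"]) auto
  qed
  obtain A :: nat where A: "max 1 (2 + \<beta> * M) \<le> real A"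
    using real_arch_simple by blast
  have "real A > 0" using A by linarith
  \<comment> \<open>\<open>n m\<close> bounds the occupied cells of a copy from below, \<open>G m\<close> the number of patterns from
    above, and \<open>\<epsilon> * m / 5 - 1\<close> is a lower bound for the number of greedy steps. The limit holds
    because the exponent grows like \<open>m powr s\<close> while \<open>G m\<close> is polynomial.\<close>
  define n where "n m = c / (2 / (real m * \<alpha>)) powr s" for m
  define G where "G m = (2 * real A * real m + 1)^2" for m
  have "(\<lambda>m. G m * exp (- (n m / (real m + 5) * (\<epsilon> * real m / 5 - 1)))) \<longlonglongrightarrow> 0"
    unfolding n_def G_def using scd assms(3,4) \<open>real A > 0\<close> by real_asymp
  then have ev1: "\<forall>\<^sub>F m in sequentially. G m * exp (- (n m / (real m + 5) * (\<epsilon> * real m / 5 - 1))) < 1"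
    by (rule order_tendstoD) simp
  have ev2: "\<forall>\<^sub>F m in sequentially. 1 / real m < \<alpha> / 2"
    using assms(3) by real_asymp
  have ev3: "\<forall>\<^sub>F m in sequentially. 2 / (real m * \<alpha>) < d"
    using assms(3) scd by real_asymp
  obtain m where m: "0 < m" "1 / real m < \<alpha> / 2" "2 / (real m * \<alpha>) < d"
    "G m * exp (- (n m / (real m + 5) * (\<epsilon> * real m / 5 - 1))) < 1"
    using eventually_happens[OF eventually_conj[OF eventually_gt_at_top[of 0]
        eventually_conj[OF ev2 eventually_conj[OF ev3 ev1]]]] by auto

  define \<rho> where "\<rho> = 2 / (real m * \<alpha>)"
  have \<rho>: "0 < \<rho>" "\<rho> \<le> d" using m assms(3) by (auto simp: \<rho>_def)
  have n_eq: "n m = c / \<rho> powr s" by (simp add: n_def \<rho>_def)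
  have n_pos: "0 < n m" using scd \<rho> by (simp add: n_eq)
  \<comment> \<open>The cells of length \<open>1/m\<close> occupied by the copy with translation \<open>i/m\<close> and scale \<open>j/(m*M)\<close>.
    The cells are numbered by integers; \<open>U\<close> exceeds the range of cells in \<open>{0..1}\<close> by the
    rounding error of two cells.\<close>
  define cells where "cells i j = (\<lambda>a. \<lfloor>real_of_int i + real_of_int j * (a / M)\<rfloor>) ` X" for i j
  define U where "U = {-2..int m + 2}"
  define I where "I = {- (int A * int m)..int A * int m}"
  define \<F> where "\<F> = {S \<in> (\<lambda>(i,j). cells i j) ` (I \<times> I). S \<subseteq> U \<and> n m \<le> real (card S)}"
  have fin\<F>: "finite \<F>" by (simp add: \<F>_def I_def)
  have cU: "real (card U) = real m + 5" by (simp add: U_def)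
  have card\<F>: "real (card \<F>) \<le> G m"
  proof -
    have "card \<F> \<le> card ((\<lambda>(i,j). cells i j) ` (I \<times> I))"
      unfolding \<F>_def by (rule card_mono) (auto simp: I_def)
    also have "\<dots> \<le> card (I \<times> I)" by (rule card_image_le) (simp add: I_def)
    finally have "real (card \<F>) \<le> real (card I) ^ 2"
      unfolding card_cartesian_product power2_eq_square of_nat_mult[symmetric] of_nat_le_iff .
    also have "real (card I) = 2 * real A * real m + 1"
    proof -
      have "card I = nat (2 * (int A * int m) + 1)" by (simp add: I_def)
      also have "\<dots> = 2 * (A * m) + 1" by (simp add: nat_eq_iff)
      finally show ?thesis by simp
    qed
    finally show ?thesis by (simp add: G_def)
  qed

  \<comment> \<open>Each chosen cell is thickened below to an interval of length \<open>5/m\<close>, hence the factor 5.\<close>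
  define r where "r = nat \<lfloor>\<epsilon> * real m / 5\<rfloor>"
  have r: "\<epsilon> * real m / 5 - 1 \<le> real r" "real r \<le> \<epsilon> * real m / 5"
    using assms(4) unfolding r_def by (simp_all add: of_nat_nat) linarith
  obtain H where H: "H \<subseteq> U" "card H \<le> r"
    "real (card {S \<in> \<F>. S \<inter> H = {}}) \<le> real (card \<F>) * (1 - n m / real (card U)) ^ r"
  proof -
    have "finite U" "\<And>S. S \<in> \<F> \<Longrightarrow> S \<subseteq> U \<and> n m \<le> real (card S)"
      by (simp_all add: U_def \<F>_def)
    from greedy_hitting_set[OF this(1) fin\<F> this(2), of r] that show ?thesis by blast
  qed
  have hit: "S \<inter> H \<noteq> {}" if "S \<in> \<F>" for S
  proof
    assume SH: "S \<inter> H = {}"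
    have "n m \<le> real (card S)" "S \<subseteq> U" using that by (simp_all add: \<F>_def)
    moreover have "card S \<le> card U" using \<open>S \<subseteq> U\<close> by (intro card_mono) (simp add: U_def)
    ultimately have "n m \<le> real (card U)" by linarith
    then have nonneg: "0 \<le> 1 - n m / real (card U)" by (simp add: cU)
    have "(1 - n m / real (card U)) ^ r \<le> exp (- (n m / real (card U))) ^ r"
      using exp_ge_add_one_self[of "- (n m / real (card U))"] nonneg by (intro power_mono) auto
    also have "\<dots> = exp (- (n m / real (card U) * real r))"
      by (simp add: exp_of_nat_mult[symmetric] mult_ac)
    also have "\<dots> \<le> exp (- (n m / (real m + 5) * (\<epsilon> * real m / 5 - 1)))"
      using n_pos r(1) unfolding cU by (auto intro!: divide_right_mono mult_left_mono)
    finally have "real (card \<F>) * (1 - n m / real (card U)) ^ r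
      \<le> G m * exp (- (n m / (real m + 5) * (\<epsilon> * real m / 5 - 1)))"
      using card\<F> nonneg by (intro mult_mono) auto
    then have "card {S \<in> \<F>. S \<inter> H = {}} = 0"
      using H(3) m(4) by linarith
    then show False using that SH fin\<F> by auto
  qed

  define J where "J k = {(real_of_int k - 2) / real m .. (real_of_int k + 3) / real m}" for k
  have finH: "finite H" using H(1) finite_subset by (auto simp: U_def)
  have mJ: "measure lebesgue (J k) = 5 / real m" for k
    using m(1) by (simp add: J_def divide_right_mono diff_divide_distrib[symmetric])
  show ?thesis
  proof (rule that[of "\<Union>k\<in>H. J k"])
    show "(\<Union>k\<in>H. J k) \<in> lmeasurable"
      using finH by (intro fmeasurable.finite_UN) (auto simp: J_def)
    have "measure lebesgue (\<Union>k\<in>H. J k) \<le> (\<Sum>k\<in>H. measure lebesgue (J k))"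
      using finH by (intro measure_UNION_le) (auto simp: J_def)
    also have "\<dots> = real (card H) * (5 / real m)" by (simp add: mJ)
    also have "\<dots> \<le> (\<epsilon> * real m / 5) * (5 / real m)"
      using H(2) r(2) by (intro mult_right_mono) auto
    also have "\<dots> = \<epsilon>" using m(1) by simp
    finally show "measure lebesgue (\<Union>k\<in>H. J k) \<le> \<epsilon>" .
  next
    fix x t assume t: "\<alpha> \<le> \<bar>t\<bar>" "\<bar>t\<bar> \<le> \<beta>" and sub: "(\<lambda>a. t * a + x) ` X \<subseteq> {0..1}"
    define i where "i = \<lfloor>x * real m\<rfloor>"
    define j where "j = \<lfloor>t * real m * M\<rfloor>"
    have i: "\<bar>x * real m - real_of_int i\<bar> \<le> 1" unfolding i_def by linarith
    have j: "\<bar>t * real m * M - real_of_int j\<bar> \<le> 1" unfolding j_def by linarith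
    have approx: "\<bar>real m * (t * a + x) - (real_of_int i + real_of_int j * (a / M))\<bar> \<le> 2"
      if "a \<in> X" for a
    proof -
      have "\<bar>(t * real m * M - real_of_int j) * (a / M)\<bar> \<le> 1 * 1"
        unfolding abs_mult using j M(1) M(2)[OF that] by (intro mult_mono) auto
      moreover have "real m * (t * a + x) - (real_of_int i + real_of_int j * (a / M))
          = (x * real m - real_of_int i) + (t * real m * M - real_of_int j) * (a / M)"
        using M(1) by (simp add: field_simps)
      ultimately show ?thesis using i by linarith
    qed
    have tM: "\<bar>t * M\<bar> \<le> \<beta> * M" using t M(1) by (simp add: abs_mult mult_right_mono)
    have "\<bar>t * a0\<bar> \<le> \<beta> * M"
      unfolding abs_mult using t M(2)[OF \<open>a0 \<in> X\<close>] by (intro mult_mono) auto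
    moreover have "t * a0 + x \<in> {0..1}" using sub \<open>a0 \<in> X\<close> by auto
    ultimately have "\<bar>x\<bar> \<le> real A - 1" "\<bar>t * M\<bar> \<le> real A - 1"
      using A tM by auto
    then have "\<bar>x * real m\<bar> \<le> (real A - 1) * real m" "\<bar>t * real m * M\<bar> \<le> (real A - 1) * real m"
      by (auto simp: abs_mult intro: mult_right_mono)
         (metis abs_mult abs_of_nat mult.assoc mult.commute mult_right_mono of_nat_0_le_iff)
    then have "\<bar>real_of_int i\<bar> \<le> (real A - 1) * real m + 1" "\<bar>real_of_int j\<bar> \<le> (real A - 1) * real m + 1"
      using i j by linarith+
    moreover have "(real A - 1) * real m + 1 \<le> real_of_int (int A * int m)"
      using m(1) by (simp add: algebra_simps)
    ultimately have ijI: "i \<in> I" "j \<in> I" unfolding I_def by (simp_all del: of_int_mult) linarith+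

    have subU: "cells i j \<subseteq> U"
    proof
      fix k assume "k \<in> cells i j"
      then obtain a where a: "a \<in> X" "k = \<lfloor>real_of_int i + real_of_int j * (a / M)\<rfloor>"
        by (auto simp: cells_def)
      have "t * a + x \<in> {0..1}" using sub a(1) by auto
      then have "0 \<le> real m * (t * a + x)" "real m * (t * a + x) \<le> real m"
        by (auto intro: mult_left_le)
      moreover define y where "y = real_of_int i + real_of_int j * (a / M)"
      ultimately have "- 2 \<le> y" "y \<le> real m + 2"
        using approx[OF a(1)] by (auto simp flip: y_def)
      then show "k \<in> U" unfolding U_def a(2) y_def[symmetric] atLeastAtMost_iff by linarith
    qed
    have "n m \<le> real (card (cells i j))"
    proof -
      \<comment> \<open>The points of \<open>X\<close> that land in a fixed cell form a set of diameter at most \<open>\<rho>\<close>, because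
        the rounded scale still has absolute value at least \<open>\<alpha>/2\<close>.\<close>
      define V where "V k = {a \<in> X. \<lfloor>real_of_int i + real_of_int j * (a / M)\<rfloor> = k}" for k
      have jM: "real m * \<alpha> / 2 \<le> \<bar>real_of_int j / M\<bar>"
      proof -
        have "\<bar>t * real m - real_of_int j / M\<bar> = \<bar>t * real m * M - real_of_int j\<bar> / M"
          using M(1) by (simp add: abs_if field_simps)
        also have "\<dots> \<le> 1" using j M(1) by (simp add: field_simps)
        finally have "\<bar>t\<bar> * real m - 1 \<le> \<bar>real_of_int j / M\<bar>"
          by (simp add: abs_mult abs_if split: if_splits)
        moreover have "\<alpha> * real m \<le> \<bar>t\<bar> * real m" using t by (intro mult_right_mono) auto
        moreover have "1 < \<alpha> * real m / 2" using m(1,2) by (simp add: field_simps)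
        ultimately have "\<alpha> * real m / 2 \<le> \<bar>real_of_int j / M\<bar>" by linarith
        then show ?thesis by (simp only: mult.commute)
      qed
      have "c \<le> real (card (cells i j)) * \<rho> powr s"
      proof (rule cover)
        show "finite (cells i j)" using subU finite_subset by (auto simp: U_def)
        show "X \<subseteq> (\<Union>k\<in>cells i j. V k)" by (auto simp: V_def cells_def)
        fix k
        have "\<bar>a - b\<bar> \<le> \<rho>" if "a \<in> V k" "b \<in> V k" for a b
        proof -
          have "\<lfloor>real_of_int i + real_of_int j * (a / M)\<rfloor> = k"
            "\<lfloor>real_of_int i + real_of_int j * (b / M)\<rfloor> = k"
            using that unfolding V_def by blast+
          then have "\<bar>real_of_int j * (a / M) - real_of_int j * (b / M)\<bar> \<le> 1" by linarith
          also have "real_of_int j * (a / M) - real_of_int j * (b / M) = real_of_int j / M * (a - b)"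
            by (simp add: right_diff_distrib)
          finally have "\<bar>real_of_int j / M * (a - b)\<bar> \<le> 1" .
          then have "real m * \<alpha> / 2 * \<bar>a - b\<bar> \<le> 1"
            using mult_right_mono[OF jM, of "\<bar>a - b\<bar>"]
            unfolding abs_mult[of "real_of_int j / M"] by linarith
          then show ?thesis using m(1) assms(3) by (simp add: \<rho>_def field_simps)
        qed
        then have "diameter (V k) \<le> \<rho>" using \<rho> by (intro diameter_le) auto
        moreover have "bounded (V k)" using assms(1) by (rule bounded_subset) (auto simp: V_def)
        ultimately show "bounded (V k) \<and> diameter (V k) \<le> \<rho>" by simp
      qed (use \<rho> in auto)
      then show ?thesis using \<rho> by (simp add: n_eq field_simps)
    qed
    then have "cells i j \<in> \<F>" using ijI subU by (auto simp: \<F>_def)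
    then obtain a where a: "a \<in> X" "\<lfloor>real_of_int i + real_of_int j * (a / M)\<rfloor> \<in> H"
      using hit[of "cells i j"] by (auto simp: cells_def)
    have "t * a + x \<in> J \<lfloor>real_of_int i + real_of_int j * (a / M)\<rfloor>"
    proof -
      define y where "y = real_of_int i + real_of_int j * (a / M)"
      have "real_of_int \<lfloor>y\<rfloor> - 2 \<le> real m * (t * a + x)" "real m * (t * a + x) \<le> real_of_int \<lfloor>y\<rfloor> + 3"
        using approx[OF a(1)] unfolding y_def[symmetric] by linarith+
      then show ?thesis using m(1) unfolding J_def y_def[symmetric]
        by (simp add: divide_le_eq le_divide_eq mult.commute)
    qed
    then show "(\<lambda>a. t * a + x) ` X \<inter> (\<Union>k\<in>H. J k) \<noteq> {}" using a by blast
  qed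
qed

section \<open>Non-universality\<close>

lemma bounded_positive_dim_not_measure_universal:
  fixes X :: "real set"
  assumes "bounded X" "hausdorff_dim X > 0"
  shows "\<not> measure_universal X"
proof
  assume univ: "measure_universal X"
  have "\<exists>F. F \<in> lmeasurable \<and> measure lebesgue F \<le> (1/2) ^ (k + 2) \<and>
      (\<forall>x t. 1 / real (Suc k) \<le> \<bar>t\<bar> \<longrightarrow> \<bar>t\<bar> \<le> real (Suc k) \<longrightarrow> (\<lambda>a. t * a + x) ` X \<subseteq> {0..1} \<longrightarrow>
        (\<lambda>a. t * a + x) ` X \<inter> F \<noteq> {})" for k :: nat
    using small_set_meeting_affine_copies[OF assms, of "1 / real (Suc k)" "(1/2) ^ (k + 2)" "real (Suc k)"]
    by (metis divide_pos_pos half_gt_zero_iff of_nat_0_less_iff zero_less_Suc zero_less_one zero_less_power)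
  \<comment> \<open>The ranges \<open>{1 / Suc k .. Suc k}\<close> exhaust the positive numbers.\<close>
  then obtain F where F: "\<And>k. F k \<in> lmeasurable" "\<And>k. measure lebesgue (F k) \<le> (1/2) ^ (k + 2)"
    "\<And>k x t. \<lbrakk>1 / real (Suc k) \<le> \<bar>t\<bar>; \<bar>t\<bar> \<le> real (Suc k); (\<lambda>a. t * a + x) ` X \<subseteq> {0..1}\<rbrakk>
      \<Longrightarrow> (\<lambda>a. t * a + x) ` X \<inter> F k \<noteq> {}"
    by metis
  have Fs: "F k \<in> sets lebesgue" for k using F(1) by auto
  define E where "E = {0..1} - (\<Union>k. F k)"
  have E: "E \<in> sets lebesgue" using Fs by (auto simp: E_def)
  have "(\<lambda>k. (1/2::real) ^ (k + 2)) sums (1/2)"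
    using sums_mult[OF geometric_sums[of "1/2::real"], of "1/4"] by (simp add: power2_eq_square)
  then have geo: "(\<Sum>k. ennreal ((1/2) ^ (k + 2))) = ennreal (1/2)"
    by (intro suminf_ennreal_eq) auto
  have "emeasure lebesgue (\<Union>k. F k) \<le> (\<Sum>k. emeasure lebesgue (F k))"
    using Fs by (intro emeasure_subadditive_countably) auto
  also have "\<dots> \<le> (\<Sum>k. ennreal ((1/2) ^ (k + 2)))"
    using F(1,2) by (intro suminf_le) (auto simp: emeasure_eq_measure2 intro!: ennreal_leI)
  finally have small: "emeasure lebesgue (\<Union>k. F k) \<le> ennreal (1/2)" unfolding geo .
  have "emeasure lebesgue E > 0"
  proof (rule ccontr)
    assume "\<not> ?thesis"
    then have "emeasure lebesgue E = 0" by simp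
    have "ennreal 1 = emeasure lebesgue {0..1::real}" by simp
    also have "\<dots> \<le> emeasure lebesgue (E \<union> (\<Union>k. F k))"
      using E Fs by (intro emeasure_mono) (auto simp: E_def)
    also have "\<dots> \<le> emeasure lebesgue E + emeasure lebesgue (\<Union>k. F k)"
      using E Fs by (intro emeasure_subadditive) auto
    also have "\<dots> \<le> ennreal (1/2)" using small \<open>emeasure lebesgue E = 0\<close> by simp
    finally have "(1::real) \<le> 1/2" by (subst (asm) ennreal_le_iff) auto
    then show False by simp
  qed
  then obtain t x where tx: "t \<noteq> 0" "(\<lambda>a. t * a + x) ` X \<subseteq> E"
    using univ E unfolding measure_universal_def by blast
  obtain k :: nat where "max \<bar>t\<bar> (1 / \<bar>t\<bar>) \<le> real k" using real_arch_simple by blast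
  then have k: "\<bar>t\<bar> \<le> real (Suc k)" "1 / \<bar>t\<bar> \<le> real (Suc k)" by auto
  then have "1 / real (Suc k) \<le> \<bar>t\<bar>" using tx(1) by (simp add: divide_le_eq mult.commute)
  then have "(\<lambda>a. t * a + x) ` X \<inter> F k \<noteq> {}"
    using F(3)[of k t x] k tx(2) by (auto simp: E_def)
  then show False using tx(2) by (auto simp: E_def)
qed

theorem corollary3p8:
  fixes X :: "real set"
  assumes "cantor_set X"
    and "hausdorff_dim X > 0"
  shows "\<not> measure_universal X"
  using assms by (intro bounded_positive_dim_not_measure_universal) (auto simp: cantor_set_def compact_imp_bounded)

end
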